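(* Let $A$ be an algebra over a field $F$ with $\mathrm{char}(F)\neq 2$, and let $a\in A$ be a flexible idempotent. Then: (i) $R_a^2-R_a=L_a^2-L_a$. (ii) $R_a(R_a+L_a-1)=L_a(R_a+L_a-1)$. (iii) If $A$ is power-associative and $\mathrm{char}(F)\neq 2,3$, then $(X_a-1)\,Y_a\,(L_a+R_a-1)=0$ for all choices of $X,Y\in\{R,L\}$.
   Context: Algebras are not necessarily associative, commutative or unital. For $a\in A$, $L_a,R_a:A\to A$ are the linear maps $L_a(x)=ax$ and $R_a(x)=xa$; products of such maps are compositions and $1$ denotes the identity map. An idempotent $a$ (i.e. $a^2=a$) is called flexible if $L_aR_a=R_aL_a$ and $(xa)x=x(ax)$ for all $x\in A$. The algebra $A$ is power-associative if for each $x\in A$ the subalgebra $F[x]$ generated by $x$ is associative. *)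

theory Defs
  imports Complex_Main "HOL-Library.Function_Algebras"
begin

locale nonassoc_algebra = vector_space scale
  for scale :: "'f::field \<Rightarrow> 'a::ab_group_add \<Rightarrow> 'a" +
  fixes mul :: "'a \<Rightarrow> 'a \<Rightarrow> 'a"
  assumes linear_left: "Vector_Spaces.linear scale scale (\<lambda>x. mul x y)"
    and linear_right: "Vector_Spaces.linear scale scale (\<lambda>y. mul x y)"

definition lmul :: "('a \<Rightarrow> 'a \<Rightarrow> 'a) \<Rightarrow> 'a \<Rightarrow> 'a \<Rightarrow> 'a" where
  "lmul mul a = (\<lambda>x. mul a x)"

definition rmul :: "('a \<Rightarrow> 'a \<Rightarrow> 'a) \<Rightarrow> 'a \<Rightarrow> 'a \<Rightarrow> 'a" where
  "rmul mul a = (\<lambda>x. mul x a)"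

definition idempotent :: "('a \<Rightarrow> 'a \<Rightarrow> 'a) \<Rightarrow> 'a \<Rightarrow> bool" where
  "idempotent mul a \<longleftrightarrow> mul a a = a"

definition flexible_idempotent :: "('a \<Rightarrow> 'a \<Rightarrow> 'a) \<Rightarrow> 'a \<Rightarrow> bool" where
  "flexible_idempotent mul a \<longleftrightarrow>
     idempotent mul a \<and>
     lmul mul a \<circ> rmul mul a = rmul mul a \<circ> lmul mul a \<and>
     (\<forall>x. mul (mul x a) x = mul x (mul a x))"

definition subalgebra ::
  "('f::field \<Rightarrow> 'a::ab_group_add \<Rightarrow> 'a) \<Rightarrow> ('a \<Rightarrow> 'a \<Rightarrow> 'a) \<Rightarrow> 'a set \<Rightarrow> bool" where
  "subalgebra scale mul S \<longleftrightarrow>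
     module.subspace scale S \<and> (\<forall>x\<in>S. \<forall>y\<in>S. mul x y \<in> S)"

(* F[x]: the smallest subalgebra containing x, with no unit adjoined. *)
definition generated_subalgebra ::
  "('f::field \<Rightarrow> 'a::ab_group_add \<Rightarrow> 'a) \<Rightarrow> ('a \<Rightarrow> 'a \<Rightarrow> 'a) \<Rightarrow> 'a \<Rightarrow> 'a set" where
  "generated_subalgebra scale mul x = subalgebra scale mul hull {x}"

definition power_associative ::
  "('f::field \<Rightarrow> 'a::ab_group_add \<Rightarrow> 'a) \<Rightarrow> ('a \<Rightarrow> 'a \<Rightarrow> 'a) \<Rightarrow> bool" where
  "power_associative scale mul \<longleftrightarrow>
     (\<forall>x. \<forall>u\<in>generated_subalgebra scale mul x. \<forall>v\<in>generated_subalgebra scale mul x.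
        \<forall>w\<in>generated_subalgebra scale mul x. mul (mul u v) w = mul u (mul v w))"

end

(* Polarizing (xa)x = x(ax) at x = a gives (i), and (ii) follows since L and R commute.
   For (iii), power-associativity gives x^2 x^2 = (x^2 x) x; at x = a + t y this is a polynomial
   identity in t. The values t = 1, -1, 2 isolate the coefficient of t up to a factor 6, and by (i)
   that coefficient says (R - 1) R (L + R - 1) = 0. By (ii) the four choices of X, Y agree. *)
theory Submission
  imports Defs
begin

context nonassoc_algebra
begin

lemma mul_add_left: "mul (x + y) z = mul x z + mul y z"
  using module_hom.add[OF linear_left[folded module_hom_iff_linear]] .

lemma mul_add_right: "mul z (x + y) = mul z x + mul z y"
  using module_hom.add[OF linear_right[folded module_hom_iff_linear]] .

lemma mul_scale_left: "mul (scale t x) z = scale t (mul x z)"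
  using module_hom.scale[OF linear_left[folded module_hom_iff_linear]] .

lemma mul_scale_right: "mul z (scale t x) = scale t (mul z x)"
  using module_hom.scale[OF linear_right[folded module_hom_iff_linear]] .

lemma mul_diff_left: "mul (x - y) z = mul x z - mul y z"
  using module_hom.diff[OF linear_left[folded module_hom_iff_linear]] .

lemma mul_diff_right: "mul z (x - y) = mul z x - mul z y"
  using module_hom.diff[OF linear_right[folded module_hom_iff_linear]] .

lemmas mul_simps = mul_add_left mul_add_right mul_scale_left mul_scale_right
  mul_diff_left mul_diff_right

text \<open>Flexibility at \<open>x + a\<close> has a part quadratic in \<open>x\<close>, which
  cancels by flexibility at \<open>x\<close>; with \<open>aa\<close> the part linear in
  \<open>x\<close> is the claim.\<close>

lemma flexible_idempotent_square_diff:
  assumes "flexible_idempotent mul a"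
  shows "mul (mul x a) a - mul x a = mul a (mul a x) - mul a x"
proof -
  have aa: "mul a a = a" and flex: "\<And>x. mul (mul x a) x = mul x (mul a x)"
    using assms by (auto simp: flexible_idempotent_def idempotent_def)
  show ?thesis
    using flex[of "x + a"] flex[of x] aa by (simp add: mul_simps algebra_simps)
qed

text \<open>Associativity inside F[x] for the triple \<open>mul x x\<close>, \<open>x\<close>,
  \<open>x\<close>.\<close>

lemma power_associative_fourth_power:
  assumes "power_associative scale mul"
  shows "mul (mul (mul x x) x) x = mul (mul x x) (mul x x)"
proof -
  let ?G = "generated_subalgebra scale mul x"
  have "x \<in> ?G"
    by (simp add: generated_subalgebra_def hull_inc)
  moreover have "mul x x \<in> ?G"
    by (auto simp: generated_subalgebra_def hull_def subalgebra_def)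
  ultimately show ?thesis
    using assms unfolding power_associative_def by blast
qed

text \<open>The weights 6, -2, -1 at t = 1, -1, 2 annihilate both t^2 and t^3 and leave 6 times the
  linear coefficient.\<close>

lemma linear_coefficient_eq_0:
  fixes c d e :: 'a
  assumes zero: "\<And>t. scale t c + scale (t ^ 2) d + scale (t ^ 3) e = 0"
    and six: "(6 :: 'f) \<noteq> 0"
  shows "c = 0"
proof -
  let ?p = "\<lambda>t. scale t c + scale (t ^ 2) d + scale (t ^ 3) e"
  have "scale 6 (?p 1) - scale 2 (?p (- 1)) - ?p 2
      = scale (6 + 2 - 2) c + scale (6 - 2 - 4) d + scale (6 + 2 - 8) e"
    by (simp only: scale_right_distrib scale_left_distrib scale_left_diff_distrib)
      (simp add: algebra_simps)
  then have "scale 6 c = 0"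
    unfolding zero by simp
  then show ?thesis
    using six by simp
qed

lemma flexible_idempotent_cubic:
  assumes "flexible_idempotent mul a" "power_associative scale mul" "(6 :: 'f) \<noteq> 0"
  shows "mul (mul (mul y a + mul a y - y) a) a = mul (mul y a + mul a y - y) a"
proof -
  have aa: "mul a a = a" and comm: "mul a (mul x a) = mul (mul a x) a" for x
    using assms(1) by (auto simp: flexible_idempotent_def idempotent_def lmul_def rmul_def fun_eq_iff)
  \<comment> \<open>With x = a + t y, the square is a + t s + t^2 q, and \<open>c\<close>,
    \<open>d\<close>, \<open>e\<close> are the coefficients of t, t^2, t^3 in (x^2 x) x - x^2
    x^2.\<close>
  define s where "s = mul a y + mul y a"
  define q where "q = mul y y"
  define c where "c = mul (mul s a + mul a y) a + mul a y - (mul a s + mul s a)"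
  define d where "d = mul (mul q a + mul s y) a + mul (mul s a + mul a y) y
      - (mul a q + mul q a + mul s s)"
  define e where "e = mul (mul q y) a + mul (mul q a + mul s y) y - (mul s q + mul q s)"
  \<comment> \<open>This kills the coefficient of t^4; the constant term vanishes because
    \<open>a\<close> is idempotent.\<close>
  have y4: "mul (mul q y) y = mul q q"
    unfolding q_def by (rule power_associative_fourth_power[OF assms(2)])
  have "scale t c + scale (t ^ 2) d + scale (t ^ 3) e = 0" for t
  proof -
    let ?x = "a + scale t y"
    have x2: "mul ?x ?x = a + scale t s + scale (t ^ 2) q"
      by (simp add: mul_simps aa s_def q_def scale_right_distrib power2_eq_square algebra_simps)
    have "mul (mul (mul ?x ?x) ?x) ?x - mul (mul ?x ?x) (mul ?x ?x)
        = scale t c + scale (t ^ 2) d + scale (t ^ 3) e"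
      unfolding x2 c_def d_def e_def
      by (simp add: mul_simps aa y4 scale_right_distrib scale_right_diff_distrib
          power2_eq_square power3_eq_cube algebra_simps)
    then show ?thesis
      using power_associative_fourth_power[OF assms(2), of ?x] by simp
  qed
  then have "c = 0"
    using assms(3) by (rule linear_coefficient_eq_0)
  \<comment> \<open>Modulo \<open>comm\<close>, the two sides differ by ((ya)a - ya) - (a(ay) - ay),
    which is zero by (i).\<close>
  moreover have "mul (mul (mul y a + mul a y - y) a) a - mul (mul y a + mul a y - y) a = c"
    using flexible_idempotent_square_diff[OF assms(1), of y] comm[of y]
    by (simp add: c_def s_def mul_simps algebra_simps)
  ultimately show ?thesis
    by simp
qed

end

text \<open>A characteristic dividing the prime 2 or 3 would be 1 or that prime, and 1 is impossible
  in a field; so 2 and 3 are nonzero, and so is their product.\<close>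

lemma six_neq_0_if_CHAR:
  assumes "CHAR('f::field) \<noteq> 2" "CHAR('f) \<noteq> 3"
  shows "(6 :: 'f) \<noteq> 0"
proof -
  have "\<not> CHAR('f) dvd n" if "n \<in> {2, 3}" for n
  proof
    assume dvd: "CHAR('f) dvd n"
    then have "CHAR('f) \<le> 3"
      using that dvd_imp_le[OF dvd] by auto
    moreover have "CHAR('f) \<noteq> 0"
      using dvd that by (metis dvd_0_left_iff insert_iff singletonD zero_neq_numeral)
    ultimately show False
      using assms CHAR_not_1'[where 'a = 'f] by linarith
  qed
  then have "of_nat 2 \<noteq> (0 :: 'f)" and "of_nat 3 \<noteq> (0 :: 'f)"
    unfolding of_nat_eq_0_iff_char_dvd by blast+
  then have "of_nat 2 * of_nat 3 \<noteq> (0 :: 'f)"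
    by (rule no_zero_divisors)
  then show ?thesis
    by simp
qed

theorem lemmaA:
  fixes scale :: "'f::field \<Rightarrow> 'a::ab_group_add \<Rightarrow> 'a"
    and mul :: "'a \<Rightarrow> 'a \<Rightarrow> 'a"
    and a :: 'a
  assumes "nonassoc_algebra scale mul"
    and "CHAR('f) \<noteq> 2"
    and "flexible_idempotent mul a"
  shows "((rmul mul a \<circ> rmul mul a) - rmul mul a = (lmul mul a \<circ> lmul mul a) - lmul mul a) \<and>
    (rmul mul a \<circ> (rmul mul a + lmul mul a - id)
       = lmul mul a \<circ> (rmul mul a + lmul mul a - id)) \<and>
    (power_associative scale mul \<and> CHAR('f) \<noteq> 2 \<and> CHAR('f) \<noteq> 3 \<longrightarrow>
       (\<forall>X\<in>{rmul mul, lmul mul}. \<forall>Y\<in>{rmul mul, lmul mul}.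
          (X a - id) \<circ> Y a \<circ> (lmul mul a + rmul mul a - id) = 0))"
proof -
  interpret nonassoc_algebra scale mul
    by (fact assms(1))
  let ?L = "lmul mul a" and ?R = "rmul mul a"
  have comm: "mul a (mul x a) = mul (mul a x) a" for x
    using assms(3) by (auto simp: flexible_idempotent_def lmul_def rmul_def fun_eq_iff)
  note sq = flexible_idempotent_square_diff[OF assms(3)]
  have i: "(?R \<circ> ?R) - ?R = (?L \<circ> ?L) - ?L"
    using sq by (simp add: lmul_def rmul_def fun_eq_iff)
  \<comment> \<open>The mixed terms a(xa) and (ax)a agree by \<open>comm\<close>; what remains is
    (i).\<close>
  have eq: "mul (mul x a + mul a x - x) a = mul a (mul x a + mul a x - x)" for x
    using sq[of x] comm[of x] by (simp add: mul_simps algebra_simps)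
  have ii: "?R \<circ> (?R + ?L - id) = ?L \<circ> (?R + ?L - id)"
    using eq by (simp add: lmul_def rmul_def fun_eq_iff)
  have iii: "(X a - id) \<circ> Y a \<circ> (?L + ?R - id) = 0"
    if "power_associative scale mul" "CHAR('f) \<noteq> 3" "X \<in> {rmul mul, lmul mul}" "Y \<in> {rmul mul, lmul mul}"
    for X Y
  proof
    fix x
    let ?t = "mul x a + mul a x - x"
    have "mul (mul ?t a) a = mul ?t a"
      using flexible_idempotent_cubic[OF assms(3) that(1) six_neq_0_if_CHAR[OF assms(2) that(2)]] .
    \<comment> \<open>Both \<open>?t\<close> and its product with \<open>a\<close> commute with
      \<open>a\<close>: a(ta) = (at)a = (ta)a. Hence the choice of \<open>X\<close> and of
      \<open>Y\<close> does not matter.\<close>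
    moreover have "mul a (mul ?t a) = mul (mul ?t a) a"
      unfolding comm[of ?t] eq[symmetric] ..
    ultimately have "X a (mul ?t a) = mul ?t a"
      using that(3) by (auto simp: lmul_def rmul_def)
    moreover have "Y a ?t = mul ?t a"
      using that(4) eq[of x] by (auto simp: lmul_def rmul_def)
    ultimately show "((X a - id) \<circ> Y a \<circ> (?L + ?R - id)) x = 0 x"
      by (simp add: lmul_def rmul_def add.commute)
  qed
  show ?thesis
    using i ii iii by blast
qed

end
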